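(* Let $A$ be a noetherian commutative $\mathbb N$-graded ring, $\mathfrak m=A_+$, and $I=(a_1,\dots,a_n)$ an ideal of $A$ such that $\mathrm{depth}_{\mathfrak m}(A)>\mathrm{depth}_I(A)=n-1$. Let $Z_1\subset A^n$ be the module of syzygies $\{(x_1,\dots,x_n):\sum x_ia_i=0\}$ and $B_1\subset Z_1$ the submodule of Koszul syzygies (generated by $a_je_i-a_ie_j$). Then the following are equivalent: (a) $B_1=Z_1\cap I\cdot A^n$; (b) $B_1=Z_1\cap\mathrm{TF}_{\mathfrak m}(I)\cdot A^n$; (c) $I$ is syzygetic.
   Context: $\mathrm{TF}_{\mathfrak m}(I)=\{a\in A:\exists m,\ a\mathfrak m^m\subset I\}$ (the saturation of $I$). $I$ is syzygetic if the kernel $\delta(I)$ of the canonical surjection $\mathrm{Sym}^2_A(I)\to I^2$ is zero. $\mathrm{depth}_{\mathfrak a}(A)$ is the grade of $\mathfrak a$. *)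

theory Defs
  imports Main "HOL-Library.Extended_Nat" "HOL-Library.Function_Algebras"
begin

definition is_ideal :: "'a::comm_ring_1 set \<Rightarrow> bool" where
  "is_ideal J \<longleftrightarrow> 0 \<in> J \<and> (\<forall>x\<in>J. \<forall>y\<in>J. x + y \<in> J) \<and> (\<forall>r x. x \<in> J \<longrightarrow> r * x \<in> J)"

definition ideal_gen :: "'a::comm_ring_1 set \<Rightarrow> 'a set" where
  "ideal_gen S = {x. \<exists>F c. finite F \<and> F \<subseteq> S \<and> x = (\<Sum>s\<in>F. c s * s)}"

definition ideal_mult :: "'a::comm_ring_1 set \<Rightarrow> 'a set \<Rightarrow> 'a set" where
  "ideal_mult J K = ideal_gen {x * y | x y. x \<in> J \<and> y \<in> K}"

fun ideal_pow :: "'a::comm_ring_1 set \<Rightarrow> nat \<Rightarrow> 'a set" where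
  "ideal_pow J 0 = UNIV"
| "ideal_pow J (Suc k) = ideal_mult J (ideal_pow J k)"

definition noetherian_ring :: "'a::comm_ring_1 itself \<Rightarrow> bool" where
  "noetherian_ring _ \<longleftrightarrow> (\<forall>J::'a set. is_ideal J \<longrightarrow> (\<exists>F. finite F \<and> J = ideal_gen F))"

definition TF :: "'a::comm_ring_1 set \<Rightarrow> 'a set \<Rightarrow> 'a set" where
  "TF m I = {a. \<exists>k. \<forall>y \<in> ideal_pow m k. a * y \<in> I}"

definition nat_graded :: "(nat \<Rightarrow> 'a::comm_ring_1 set) \<Rightarrow> bool" where
  "nat_graded G \<longleftrightarrow>
     (\<forall>i. 0 \<in> G i \<and> (\<forall>x\<in>G i. \<forall>y\<in>G i. x + y \<in> G i) \<and> (\<forall>x\<in>G i. - x \<in> G i)) \<and>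
     (\<forall>i j. \<forall>x\<in>G i. \<forall>y\<in>G j. x * y \<in> G (i + j)) \<and>
     (\<forall>x. \<exists>!h::nat \<Rightarrow> 'a. finite {i. h i \<noteq> 0} \<and> (\<forall>i. h i \<in> G i) \<and>
                          x = (\<Sum>i\<in>{i. h i \<noteq> 0}. h i))"

definition irrelevant :: "(nat \<Rightarrow> 'a::comm_ring_1 set) \<Rightarrow> 'a set" where
  "irrelevant G = {x. \<exists>F h. finite F \<and> F \<subseteq> {1..} \<and> (\<forall>i\<in>F. h i \<in> G i) \<and> x = (\<Sum>i\<in>F. h i)}"

definition regular_seq :: "'a::comm_ring_1 list \<Rightarrow> bool" where
  "regular_seq xs \<longleftrightarrow>
     (\<forall>i < length xs. \<forall>y. xs ! i * y \<in> ideal_gen (set (take i xs)) \<longrightarrow> y \<in> ideal_gen (set (take i xs))) \<and>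
     ideal_gen (set xs) \<noteq> UNIV"

definition grade :: "'a::comm_ring_1 set \<Rightarrow> enat" where
  "grade J = (if J = UNIV then \<infinity>
              else Sup {enat (length xs) | xs. regular_seq xs \<and> set xs \<subseteq> J})"

definition freemod :: "nat \<Rightarrow> (nat \<Rightarrow> 'a::comm_ring_1) set" where
  "freemod n = {x. \<forall>i\<ge>n. x i = 0}"

definition submod_gen :: "(nat \<Rightarrow> 'a::comm_ring_1) set \<Rightarrow> (nat \<Rightarrow> 'a) set" where
  "submod_gen S = {x. \<exists>F c. finite F \<and> F \<subseteq> S \<and> x = (\<Sum>v\<in>F. (\<lambda>k. c v * v k))}"

definition syzygies :: "nat \<Rightarrow> (nat \<Rightarrow> 'a::comm_ring_1) \<Rightarrow> (nat \<Rightarrow> 'a) set" where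
  "syzygies n a = {x \<in> freemod n. (\<Sum>i<n. x i * a i) = 0}"

definition koszul_syz :: "(nat \<Rightarrow> 'a::comm_ring_1) \<Rightarrow> nat \<Rightarrow> nat \<Rightarrow> (nat \<Rightarrow> 'a)" where
  "koszul_syz a i j = (\<lambda>k. (if k = i then a j else 0) - (if k = j then a i else 0))"

definition koszul_syzygies :: "nat \<Rightarrow> (nat \<Rightarrow> 'a::comm_ring_1) \<Rightarrow> (nat \<Rightarrow> 'a) set" where
  "koszul_syzygies n a = submod_gen {koszul_syz a i j | i j. i < n \<and> j < n}"

definition ideal_freemod :: "'a::comm_ring_1 set \<Rightarrow> nat \<Rightarrow> (nat \<Rightarrow> 'a) set" where
  "ideal_freemod J n = {x \<in> freemod n. \<forall>i<n. x i \<in> J}"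

text \<open>\<open>Sym^2_A(I) = (I \<otimes>_A I)/\<langle>x\<otimes>y - y\<otimes>x\<rangle>\<close> presented as the free abelian group on
  \<open>I \<times> I\<close> (finitely supported \<open>int\<close>-valued functions) modulo the subgroup generated by
  biadditivity, A-balancedness and symmetry relations.\<close>
definition fsym :: "'a \<times> 'a \<Rightarrow> ('a \<times> 'a \<Rightarrow> int)" where
  "fsym p = (\<lambda>q. if q = p then 1 else 0)"

inductive_set sym2_rel :: "'a::comm_ring_1 set \<Rightarrow> ('a \<times> 'a \<Rightarrow> int) set" for I where
  zero: "(\<lambda>_. 0) \<in> sym2_rel I"
| add: "u \<in> sym2_rel I \<Longrightarrow> v \<in> sym2_rel I \<Longrightarrow> u + v \<in> sym2_rel I"
| neg: "u \<in> sym2_rel I \<Longrightarrow> - u \<in> sym2_rel I"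
| addl: "x \<in> I \<Longrightarrow> x' \<in> I \<Longrightarrow> y \<in> I \<Longrightarrow>
           fsym (x + x', y) - fsym (x, y) - fsym (x', y) \<in> sym2_rel I"
| addr: "x \<in> I \<Longrightarrow> y \<in> I \<Longrightarrow> y' \<in> I \<Longrightarrow>
           fsym (x, y + y') - fsym (x, y) - fsym (x, y') \<in> sym2_rel I"
| scal: "x \<in> I \<Longrightarrow> y \<in> I \<Longrightarrow> fsym (r * x, y) - fsym (x, r * y) \<in> sym2_rel I"
| symm: "x \<in> I \<Longrightarrow> y \<in> I \<Longrightarrow> fsym (x, y) - fsym (y, x) \<in> sym2_rel I"

text \<open>I is syzygetic iff the kernel of \<open>Sym^2(I) \<rightarrow> I^2\<close>, \<open>[x y] \<mapsto> x y\<close>, is zero: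
  every formal combination over \<open>I \<times> I\<close> mapping to 0 lies in the relation subgroup.\<close>
definition syzygetic :: "'a::comm_ring_1 set \<Rightarrow> bool" where
  "syzygetic I \<longleftrightarrow>
     (\<forall>f::'a \<times> 'a \<Rightarrow> int. finite {p. f p \<noteq> 0} \<and> {p. f p \<noteq> 0} \<subseteq> I \<times> I \<and>
        (\<Sum>p\<in>{p. f p \<noteq> 0}. of_int (f p) * fst p * snd p) = 0
        \<longrightarrow> f \<in> sym2_rel I)"

end

theory Submission
  imports Defs "HOL.Modules"
begin

text \<open>
  (a) \<open>\<Leftrightarrow>\<close> (c) holds for every ideal: \<open>b \<mapsto> \<Sum> a\<^sub>i b\<^sub>i\<close> defines a surjection \<open>I A\<^sup>n \<rightarrow> Sym\<^sup>2(I)\<close> with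
  kernel \<open>B\<^sub>1\<close>, under which the kernel of \<open>Sym\<^sup>2(I) \<rightarrow> I\<^sup>2\<close> becomes \<open>(Z\<^sub>1 \<inter> I A\<^sup>n)/B\<^sub>1\<close>.

  For (a) \<open>\<Rightarrow>\<close> (b), a syzygy \<open>z\<close> with entries in the saturation of \<open>I\<close> satisfies
  \<open>m\<^sup>k z \<subseteq> Z\<^sub>1 \<inter> I A\<^sup>n = B\<^sub>1\<close>, so it suffices that no nonzero class of \<open>H\<^sub>1(a) = Z\<^sub>1/B\<^sub>1\<close> is
  annihilated by \<open>m\<close>. Let \<open>x\<close> be a regular sequence of length \<open>n - 1\<close> in \<open>I\<close>. Dividing out its
  members one at a time, each killing Koszul homology, transports such a class to one in
  \<open>H\<^sub>n(a; A/(x)) \<subseteq> A/(x)\<close>. Finally \<open>A/(x)\<close> has no nonzero element annihilated by \<open>m\<close>: for a regular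
  sequence \<open>y\<close> of length \<open>n\<close> in \<open>m\<close>, the Koszul homology \<open>H\<^sub>i(y; A/(x\<^sub>1, \<dots>, x\<^sub>j))\<close> vanishes for
  \<open>i > j\<close>, and \<open>H\<^sub>n(y; A/(x))\<close> is the annihilator of \<open>y\<close> in \<open>A/(x)\<close>.
\<close>

section \<open>Ideals and modules of functions\<close>

lemma module_mult: "module ((*) :: 'a::comm_ring_1 \<Rightarrow> 'a \<Rightarrow> 'a)"
  by standard (simp_all add: algebra_simps)

lemma subspace_mult_eq_is_ideal: "module.subspace ((*) :: 'a::comm_ring_1 \<Rightarrow> 'a \<Rightarrow> 'a) = is_ideal"
  by (auto simp: fun_eq_iff module.subspace_def[OF module_mult] is_ideal_def)

lemma span_mult_eq_ideal_gen: "module.span ((*) :: 'a::comm_ring_1 \<Rightarrow> 'a \<Rightarrow> 'a) = ideal_gen"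
  by (auto simp: fun_eq_iff module.span_explicit[OF module_mult] ideal_gen_def)

interpretation ideal: module "(*) :: 'a::comm_ring_1 \<Rightarrow> 'a \<Rightarrow> 'a"
  rewrites "module.subspace ((*) :: 'a \<Rightarrow> 'a \<Rightarrow> 'a) = is_ideal"
    and "module.span ((*) :: 'a \<Rightarrow> 'a \<Rightarrow> 'a) = ideal_gen"
  by (rule module_mult subspace_mult_eq_is_ideal span_mult_eq_ideal_gen)+

text \<open>As a simplification rule it would loop with associativity in \<open>algebra_simps\<close>.\<close>
declare ideal.scale_scale [simp del]

definition fun_scale :: "'a::comm_ring_1 \<Rightarrow> ('i \<Rightarrow> 'a) \<Rightarrow> 'i \<Rightarrow> 'a"  (infixr \<open>*\<^sub>v\<close> 75) where
  "c *\<^sub>v v = (\<lambda>i. c * v i)"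

lemma fun_scale_apply [simp]: "(c *\<^sub>v v) i = c * v i"
  by (simp add: fun_scale_def)

interpretation funs: module "fun_scale :: 'a::comm_ring_1 \<Rightarrow> ('i \<Rightarrow> 'a) \<Rightarrow> 'i \<Rightarrow> 'a"
  by standard (simp_all add: fun_eq_iff algebra_simps)

lemma sum_fun_apply [simp]: "(\<Sum>i\<in>F. f i) x = (\<Sum>i\<in>F. f i x)"
  by (induction F rule: infinite_finite_induct) simp_all

lemma submod_gen_eq_span: "submod_gen S = funs.span S"
  by (auto simp: submod_gen_def funs.span_explicit fun_scale_def)

lemma span_unit_functions:
  fixes X :: "'i set"
  shows "funs.span ((\<lambda>i. 0(i := 1)) ` X) =
    {v :: 'i \<Rightarrow> 'a::comm_ring_1. finite {i. v i \<noteq> 0} \<and> (\<forall>i. i \<notin> X \<longrightarrow> v i = 0)}" (is "_ = ?R")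
proof (rule funs.span_subspace)
  show "(\<lambda>i. 0(i := 1)) ` X \<subseteq> ?R"
    by auto
  show "?R \<subseteq> funs.span ((\<lambda>i. 0(i := 1)) ` X)"
  proof
    fix v assume v: "v \<in> ?R"
    then have "v = (\<Sum>i | v i \<noteq> 0. v i *\<^sub>v 0(i := 1))"
      by (simp add: fun_eq_iff if_distrib[of "\<lambda>c. _ * c"] cong: if_cong)
    also have "\<dots> \<in> funs.span ((\<lambda>i. 0(i := 1)) ` X)"
      using v by (intro funs.span_sum funs.span_scale funs.span_base) auto
    finally show "v \<in> funs.span ((\<lambda>i. 0(i := 1)) ` X)" .
  qed
  have "finite {i. u i + v i \<noteq> 0}"
    if "finite {i. u i \<noteq> 0}" "finite {i. v i \<noteq> 0}" for u v :: "'i \<Rightarrow> 'a"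
    by (rule finite_subset[OF _ finite_UnI[OF that]]) auto
  moreover have "finite {i. c * v i \<noteq> 0}" if "finite {i. v i \<noteq> 0}" for c and v :: "'i \<Rightarrow> 'a"
    by (rule finite_subset[OF _ that]) auto
  ultimately show "funs.subspace ?R"
    by (auto simp: funs.subspace_def)
qed

lemma span_unit_functions_finite:
  fixes X :: "'i set"
  assumes "finite X"
  shows "funs.span ((\<lambda>i. 0(i := 1)) ` X) = {v :: 'i \<Rightarrow> 'a::comm_ring_1. \<forall>i. i \<notin> X \<longrightarrow> v i = 0}"
proof -
  have "finite {i. v i \<noteq> 0}" if "\<forall>i. i \<notin> X \<longrightarrow> v i = 0" for v :: "'i \<Rightarrow> 'a"
    by (rule finite_subset[OF _ assms]) (use that in auto)
  then show ?thesis
    by (auto simp: span_unit_functions)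
qed

lemma freemod_eq_span: "freemod n = funs.span ((\<lambda>i. 0(i := 1)) ` {..<n})"
  by (auto simp: freemod_def span_unit_functions_finite)

lemma subspace_freemod: "funs.subspace (freemod n)"
  by (simp add: freemod_eq_span)

definition lincomb :: "nat \<Rightarrow> (nat \<Rightarrow> 'a::comm_ring_1) \<Rightarrow> (nat \<Rightarrow> 'a) \<Rightarrow> 'a" where
  "lincomb n a x = (\<Sum>i<n. x i * a i)"

interpretation lincomb: module_hom fun_scale "(*)" "lincomb n a"
  rewrites "module.subspace ((*) :: 'a \<Rightarrow> 'a \<Rightarrow> 'a) = is_ideal"
    and "module.span ((*) :: 'a \<Rightarrow> 'a \<Rightarrow> 'a) = ideal_gen"
  for n and a :: "nat \<Rightarrow> 'a::comm_ring_1"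
proof -
  show "module_hom fun_scale (*) (lincomb n a)"
    by standard (simp_all add: lincomb_def sum.distrib sum_distrib_left algebra_simps)
qed (rule subspace_mult_eq_is_ideal span_mult_eq_ideal_gen)+

lemma lincomb_single: "i < n \<Longrightarrow> lincomb n a (0(i := c)) = c * a i"
  by (simp add: lincomb_def if_distrib[of "\<lambda>c. c * _"] cong: if_cong)

lemma ideal_gen_image_eq_lincomb: "ideal_gen (a ` {..<n}) = lincomb n a ` freemod n"
proof -
  have "a ` {..<n} = lincomb n a ` (\<lambda>i. 0(i := 1)) ` {..<n}"
    by (auto simp: lincomb_single image_image)
  then show ?thesis
    by (simp only: lincomb.span_image freemod_eq_span)
qed

lemma is_ideal_ideal_pow: "is_ideal (ideal_pow m k)"
  by (cases k) (simp_all add: ideal_mult_def)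

lemma ideal_pow_antimono:
  assumes "k \<le> l"
  shows "ideal_pow m l \<subseteq> ideal_pow m k"
  using assms
proof (induction l rule: dec_induct)
  case (step l)
  have "ideal_pow m (Suc l) \<subseteq> ideal_pow m l"
    unfolding ideal_pow.simps ideal_mult_def
    by (rule ideal.span_minimal[OF _ is_ideal_ideal_pow])
       (auto intro: ideal.subspace_scale[OF is_ideal_ideal_pow])
  with step.IH show ?case by blast
qed simp

lemma subset_TF: "is_ideal J \<Longrightarrow> J \<subseteq> TF m J"
  using ideal.subspace_scale[of J] by (fastforce simp: TF_def mult.commute)

lemma TF_common_exponent:
  assumes "finite X" "\<And>i. i \<in> X \<Longrightarrow> z i \<in> TF m J"
  obtains k where "\<And>i y. i \<in> X \<Longrightarrow> y \<in> ideal_pow m k \<Longrightarrow> z i * y \<in> J"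
proof -
  have "\<forall>i\<in>X. \<exists>k. \<forall>y\<in>ideal_pow m k. z i * y \<in> J"
    using assms(2) by (auto simp: TF_def)
  then obtain K where K: "\<And>i y. i \<in> X \<Longrightarrow> y \<in> ideal_pow m (K i) \<Longrightarrow> z i * y \<in> J"
    by metis
  show thesis
  proof (rule that)
    fix i y assume "i \<in> X" "y \<in> ideal_pow m (\<Sum>i\<in>X. K i)"
    moreover have "K i \<le> (\<Sum>i\<in>X. K i)"
      using \<open>i \<in> X\<close> assms(1) by (intro member_le_sum) auto
    ultimately show "z i * y \<in> J"
      using K ideal_pow_antimono by blast
  qed
qed

section \<open>Regular sequences\<close>

definition colon :: "'a::comm_ring_1 set \<Rightarrow> 'a set \<Rightarrow> 'a set" where
  "colon J S = {u. \<forall>s\<in>S. s * u \<in> J}"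

definition weakly_regular :: "'a::comm_ring_1 list \<Rightarrow> bool" where
  "weakly_regular xs \<longleftrightarrow>
     (\<forall>i<length xs. colon (ideal_gen (set (take i xs))) {xs ! i} \<subseteq> ideal_gen (set (take i xs)))"

lemma weakly_regular_snoc:
  "weakly_regular (xs @ [x]) \<longleftrightarrow>
     weakly_regular xs \<and> colon (ideal_gen (set xs)) {x} \<subseteq> ideal_gen (set xs)"
  by (auto simp: weakly_regular_def nth_append less_Suc_eq)

lemma weakly_regular_take: "weakly_regular xs \<Longrightarrow> weakly_regular (take k xs)"
  by (simp add: weakly_regular_def min_def)

lemma regular_seq_imp_weakly_regular: "regular_seq xs \<Longrightarrow> weakly_regular xs"
  by (auto simp: regular_seq_def weakly_regular_def colon_def)

lemma weakly_regular_of_grade: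
  assumes "enat k \<le> grade J"
  obtains xs where "length xs = k" "weakly_regular xs" "set xs \<subseteq> J"
proof (cases "J = UNIV \<or> k = 0")
  case True
  have "weakly_regular (replicate k (1::'a))"
    by (simp add: weakly_regular_def colon_def)
  with True show thesis
    by (intro that[of "replicate k 1"]) auto
next
  case False
  then obtain l where "k = Suc l"
    using not0_implies_Suc by blast
  with assms False have "enat l < Sup {enat (length xs) | xs. regular_seq xs \<and> set xs \<subseteq> J}"
    by (simp add: grade_def Suc_ile_eq)
  then obtain xs where "regular_seq xs" "set xs \<subseteq> J" "k \<le> length xs"
    using \<open>k = Suc l\<close> by (auto simp: less_Sup_iff)
  then show thesis
    using set_take_subset[of k xs]
    by (intro that[of "take k xs"] weakly_regular_take regular_seq_imp_weakly_regular) auto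
qed

section \<open>The Koszul complex\<close>

definition ksign :: "nat \<Rightarrow> nat set \<Rightarrow> 'a::comm_ring_1" where
  "ksign i T = (-1) ^ card {t \<in> T. t < i}"

text \<open>A Koszul chain of degree \<open>p\<close> is given by its coefficients on the basis
  \<open>e\<^sub>T = e\<^bsub>t\<^sub>1\<^esub> \<and> \<dots> \<and> e\<^bsub>t\<^sub>p\<^esub>\<close> of the exterior power, where \<open>T = {t\<^sub>1 < \<dots> < t\<^sub>p}\<close>.\<close>
definition kchain :: "nat \<Rightarrow> nat \<Rightarrow> (nat set \<Rightarrow> 'a::comm_ring_1) set" where
  "kchain n p = {z. \<forall>T. z T \<noteq> 0 \<longrightarrow> T \<subseteq> {..<n} \<and> card T = p}"

definition kdiff :: "nat \<Rightarrow> (nat \<Rightarrow> 'a::comm_ring_1) \<Rightarrow> (nat set \<Rightarrow> 'a) \<Rightarrow> nat set \<Rightarrow> 'a" where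
  "kdiff n a z T = (\<Sum>i<n. if i \<in> T then 0 else ksign i T * a i * z (insert i T))"

definition kwedge :: "nat \<Rightarrow> (nat \<Rightarrow> 'a::comm_ring_1) \<Rightarrow> (nat set \<Rightarrow> 'a) \<Rightarrow> nat set \<Rightarrow> 'a" where
  "kwedge n h z T = (\<Sum>i<n. if i \<in> T then ksign i T * h i * z (T - {i}) else 0)"

interpretation kdiff: module_hom fun_scale fun_scale "kdiff n a"
  for n and a :: "nat \<Rightarrow> 'a::comm_ring_1"
proof
  show "kdiff n a (z + w) = kdiff n a z + kdiff n a w" for z w
    by (auto simp: fun_eq_iff kdiff_def distrib_left simp flip: sum.distrib intro!: sum.cong)
  show "kdiff n a (c *\<^sub>v z) = c *\<^sub>v kdiff n a z" for c z
    by (auto simp: fun_eq_iff kdiff_def sum_distrib_left mult_ac intro!: sum.cong)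
qed

interpretation kwedge: module_hom fun_scale fun_scale "kwedge n h"
  for n and h :: "nat \<Rightarrow> 'a::comm_ring_1"
proof
  show "kwedge n h (z + w) = kwedge n h z + kwedge n h w" for z w
    by (auto simp: fun_eq_iff kwedge_def distrib_left simp flip: sum.distrib intro!: sum.cong)
  show "kwedge n h (c *\<^sub>v z) = c *\<^sub>v kwedge n h z" for c z
    by (auto simp: fun_eq_iff kwedge_def sum_distrib_left mult_ac intro!: sum.cong)
qed

lemma ksign_empty [simp]: "ksign i {} = 1"
  by (simp add: ksign_def)

lemma ksign_insert:
  assumes "j \<notin> T"
  shows "ksign i (insert j T) = (if j < i then - ksign i T else ksign i T :: 'a::comm_ring_1)"
proof -
  have "{t \<in> insert j T. t < i} = (if j < i then insert j {t \<in> T. t < i} else {t \<in> T. t < i})"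
    by auto
  then show ?thesis
    using assms by (simp add: ksign_def)
qed

lemma ksign_remove:
  assumes "j \<in> T"
  shows "ksign i (T - {j}) = (if j < i then - ksign i T else ksign i T :: 'a::comm_ring_1)"
  using ksign_insert[of j "T - {j}" i, where 'a='a] assms
  by (auto simp: insert_absorb split: if_splits)

lemma ksign_square: "ksign i T * ksign i T = (1 :: 'a::comm_ring_1)"
  by (simp add: ksign_def flip: power_mult_distrib)

lemma kchain_eq_span: "kchain n p = funs.span ((\<lambda>T. 0(T := 1)) ` {T. T \<subseteq> {..<n} \<and> card T = p})"
proof -
  have "finite {T. T \<subseteq> {..<n} \<and> card T = p}"
    by (rule finite_subset[of _ "Pow {..<n}"]) auto
  then show ?thesis
    by (auto simp: span_unit_functions_finite kchain_def)
qed

lemma subspace_kchain: "funs.subspace (kchain n p)"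
  by (simp add: kchain_eq_span)

lemma kchain_eq_0:
  assumes "n < p"
  shows "kchain n p = {0}"
proof -
  have "z T = 0" if "z \<in> kchain n p" for z :: "nat set \<Rightarrow> 'a" and T
    using that assms card_mono[of "{..<n}" T] by (force simp: kchain_def)
  then show ?thesis
    using funs.subspace_0[OF subspace_kchain] by (auto simp: fun_eq_iff)
qed

lemma kdiff_kchain:
  assumes "z \<in> kchain n (Suc p)"
  shows "kdiff n a z \<in> kchain n p"
  unfolding kchain_def
proof (intro CollectI allI impI)
  fix T assume "kdiff n a z T \<noteq> 0"
  then obtain i where i: "i \<notin> T" "z (insert i T) \<noteq> 0"
    unfolding kdiff_def by (elim sum.not_neutral_contains_not_neutral) (metis mult_zero_right)
  with assms have "insert i T \<subseteq> {..<n}" "card (insert i T) = Suc p"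
    by (auto simp: kchain_def)
  moreover from this have "finite T"
    using finite_subset by fastforce
  ultimately show "T \<subseteq> {..<n} \<and> card T = p"
    using i by simp
qed

lemma kwedge_kchain:
  assumes "z \<in> kchain n p"
  shows "kwedge n h z \<in> kchain n (Suc p)"
  unfolding kchain_def
proof (intro CollectI allI impI)
  fix T assume "kwedge n h z T \<noteq> 0"
  then obtain i where i: "i \<in> T" "i < n" "z (T - {i}) \<noteq> 0"
    unfolding kwedge_def
    by (elim sum.not_neutral_contains_not_neutral) (metis lessThan_iff mult_zero_right)
  with assms have "T - {i} \<subseteq> {..<n}" "card (T - {i}) = p"
    by (auto simp: kchain_def)
  moreover from this have "finite T"
    using finite_subset by fastforce
  ultimately show "T \<subseteq> {..<n} \<and> card T = Suc p"
    using i card_Suc_Diff1[of T i] by auto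
qed

lemma alternating_double_sum:
  fixes g :: "nat \<Rightarrow> nat \<Rightarrow> 'a::ab_group_add"
  assumes "\<And>i. g i i = 0" "\<And>i j. g i j = - g j i"
  shows "(\<Sum>i<n. \<Sum>j<n. g i j) = 0"
proof (induction n)
  case (Suc n)
  have "(\<Sum>i<n. g i n) = - (\<Sum>j<n. g n j)"
    unfolding sum_negf[symmetric] by (rule sum.cong) (auto intro: assms(2))
  with Suc show ?case
    by (simp add: sum.distrib assms(1))
qed simp

lemma kdiff_kdiff: "kdiff n a (kdiff n a z) = 0"
proof
  fix T
  define g where "g i j = (if i \<in> T \<or> j \<in> insert i T then 0 else
     ksign i T * a i * (ksign j (insert i T) * a j * z (insert j (insert i T))))" for i j
  have "g i j = - g j i" for i j
  proof (cases "i \<in> T \<or> j \<in> T \<or> i = j")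
    case False
    moreover have "insert i (insert j T) = insert j (insert i T)"
      by auto
    ultimately show ?thesis
      by (cases "i < j") (simp_all add: g_def ksign_insert mult_ac)
  qed (auto simp: g_def)
  then have "(\<Sum>i<n. \<Sum>j<n. g i j) = 0"
    by (intro alternating_double_sum) (simp add: g_def)
  moreover have "kdiff n a (kdiff n a z) T = (\<Sum>i<n. \<Sum>j<n. g i j)"
    unfolding kdiff_def by (intro sum.cong refl) (auto simp: g_def sum_distrib_left intro!: sum.cong)
  ultimately show "kdiff n a (kdiff n a z) T = 0 T"
    by simp
qed

lemma kdiff_kwedge_homotopy:
  "kdiff n a (kwedge n h z) + kwedge n h (kdiff n a z) = lincomb n a h *\<^sub>v z"
proof
  fix T
  define f where "f i j = (if i \<in> T \<or> j \<notin> insert i T then 0 else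
     ksign i T * a i * (ksign j (insert i T) * h j * z (insert i T - {j})))" for i j
  define g where "g i j = (if j \<notin> T \<or> i \<in> T - {j} then 0 else
     ksign j T * h j * (ksign i (T - {j}) * a i * z (insert i (T - {j}))))" for i j
  have fg: "f i j + g i j = (if i = j then h i * a i * z T else 0)" for i j
  proof (cases "i = j")
    case True
    have "ksign i T * a i * (ksign i T * h i * z T) = (ksign i T * ksign i T) * (h i * a i * z T)"
      "ksign i T * h i * (ksign i T * a i * z T) = (ksign i T * ksign i T) * (h i * a i * z T)"
      by (simp_all add: algebra_simps)
    with True show ?thesis
      by (auto simp: f_def g_def ksign_square ksign_insert ksign_remove insert_absorb)
  next
    case False
    then have "insert i T - {j} = insert i (T - {j})"
      by auto
    with False show ?thesis
      by (cases "i < j") (auto simp: f_def g_def ksign_insert ksign_remove algebra_simps)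
  qed
  have "kdiff n a (kwedge n h z) T = (\<Sum>i<n. \<Sum>j<n. f i j)"
    unfolding kdiff_def kwedge_def
    by (intro sum.cong refl) (auto simp: f_def sum_distrib_left intro!: sum.cong)
  moreover have "kwedge n h (kdiff n a z) T = (\<Sum>j<n. \<Sum>i<n. g i j)"
    unfolding kdiff_def kwedge_def
    by (intro sum.cong refl) (auto simp: g_def sum_distrib_left intro!: sum.cong)
  moreover have "(\<Sum>j<n. \<Sum>i<n. g i j) = (\<Sum>i<n. \<Sum>j<n. g i j)"
    by (rule sum.swap)
  moreover have "(\<Sum>i<n. \<Sum>j<n. f i j) + (\<Sum>i<n. \<Sum>j<n. g i j) = lincomb n a h * z T"
    by (simp add: fg lincomb_def sum_distrib_right flip: sum.distrib)
  ultimately show "(kdiff n a (kwedge n h z) + kwedge n h (kdiff n a z)) T = (lincomb n a h *\<^sub>v z) T"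
    by simp
qed

section \<open>Koszul homology with coefficients in a quotient ring\<close>

definition funs_in :: "'a set \<Rightarrow> ('i \<Rightarrow> 'a) set" where
  "funs_in J = {v. \<forall>i. v i \<in> J}"

lemma funs_in_zero: "funs_in {0} = {0}"
  by (auto simp: funs_in_def fun_eq_iff)

lemma subspace_funs_in: "is_ideal J \<Longrightarrow> funs.subspace (funs_in J)"
  by (simp add: funs_in_def funs.subspace_def is_ideal_def)

lemma funs_in_cancel_scale: "colon J {x} \<subseteq> J \<Longrightarrow> x *\<^sub>v v \<in> funs_in J \<Longrightarrow> v \<in> funs_in J"
  by (auto simp: colon_def funs_in_def)

lemma kdiff_funs_in: "is_ideal J \<Longrightarrow> z \<in> funs_in J \<Longrightarrow> kdiff n a z \<in> funs_in J"
  by (auto simp: funs_in_def kdiff_def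
        intro!: ideal.subspace_sum ideal.subspace_scale ideal.subspace_0)

lemma kwedge_funs_in: "is_ideal J \<Longrightarrow> z \<in> funs_in J \<Longrightarrow> kwedge n h z \<in> funs_in J"
  by (auto simp: funs_in_def kwedge_def
        intro!: ideal.subspace_sum ideal.subspace_scale ideal.subspace_0)

lemma funs_in_ideal_gen_insertI:
  assumes "v - x *\<^sub>v t \<in> funs_in (ideal_gen X)"
  shows "v \<in> funs_in (ideal_gen (insert x X))"
  using assms by (auto simp: funs_in_def ideal.span_breakdown_eq mult.commute[of x])

lemma kchain_ideal_gen_insertE:
  assumes "v \<in> kchain n p" "v \<in> funs_in (ideal_gen (insert x X))"
  obtains t where "t \<in> kchain n p" "v - x *\<^sub>v t \<in> funs_in (ideal_gen X)"
proof -
  have "\<exists>r. v T - r * x \<in> ideal_gen X" for T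
    using assms(2) by (simp add: funs_in_def ideal.span_breakdown_eq)
  then obtain r where r: "\<And>T. v T - r T * x \<in> ideal_gen X"
    by metis
  define t where "t T = (if v T = 0 then 0 else r T)" for T
  have "t \<in> kchain n p"
    using assms(1) by (auto simp: kchain_def t_def)
  moreover have "v - x *\<^sub>v t \<in> funs_in (ideal_gen X)"
    using r by (auto simp: funs_in_def t_def ideal.span_zero mult.commute)
  ultimately show thesis
    by (rule that)
qed

text \<open>Lifts to \<open>A\<close> of the cycles and boundaries of the Koszul complex of \<open>a\<close> over \<open>A/J\<close>.\<close>
definition kcycles :: "nat \<Rightarrow> (nat \<Rightarrow> 'a::comm_ring_1) \<Rightarrow> 'a set \<Rightarrow> nat \<Rightarrow> (nat set \<Rightarrow> 'a) set" where
  "kcycles n a J p = {z \<in> kchain n p. kdiff n a z \<in> funs_in J}"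

definition kboundaries :: "nat \<Rightarrow> (nat \<Rightarrow> 'a::comm_ring_1) \<Rightarrow> 'a set \<Rightarrow> nat \<Rightarrow> (nat set \<Rightarrow> 'a) set" where
  "kboundaries n a J p = {z. \<exists>u\<in>kchain n (Suc p). z - kdiff n a u \<in> funs_in J}"

text \<open>No nonzero class in \<open>H\<^sub>p(a; A/J)\<close> is annihilated by \<open>S\<close>.\<close>
definition ktorsion_free ::
    "nat \<Rightarrow> (nat \<Rightarrow> 'a::comm_ring_1) \<Rightarrow> 'a set \<Rightarrow> 'a set \<Rightarrow> nat \<Rightarrow> bool" where
  "ktorsion_free n a S J p \<longleftrightarrow>
     (\<forall>z\<in>kcycles n a J p. (\<forall>s\<in>S. s *\<^sub>v z \<in> kboundaries n a J p) \<longrightarrow> z \<in> kboundaries n a J p)"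

lemma ktorsion_free_empty: "ktorsion_free n a {} J p \<longleftrightarrow> kcycles n a J p \<subseteq> kboundaries n a J p"
  by (auto simp: ktorsion_free_def)

lemma kboundaries_zero: "kboundaries n a {0} p = kdiff n a ` kchain n (Suc p)"
  by (auto simp: kboundaries_def funs_in_zero)

lemma kboundaries_top: "n \<le> p \<Longrightarrow> kboundaries n a J p = funs_in J"
  by (simp add: kboundaries_def kchain_eq_0)

lemma ktorsion_free_top: "n \<le> p \<Longrightarrow> colon J S \<subseteq> J \<Longrightarrow> ktorsion_free n a S J p"
  by (auto simp: ktorsion_free_def kboundaries_top funs_in_def colon_def)

lemma kcycles_subset_kboundaries_above:
  assumes "n < p" "is_ideal J"
  shows "kcycles n a J p \<subseteq> kboundaries n a J p"
  using assms funs.subspace_0[OF subspace_funs_in]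
  by (auto simp: kcycles_def kchain_eq_0 kboundaries_top)

text \<open>With \<open>x = \<Sum> h\<^sub>i a\<^sub>i\<close>, the class of \<open>h \<and> z\<close> is a preimage of the class of \<open>z\<close> under the
  connecting map \<open>H\<^bsub>p+1\<^esub>(a; A/(X,x)) \<rightarrow> H\<^sub>p(a; A/X)\<close>, and it inherits the annihilators of \<open>z\<close>.\<close>
lemma kwedge_kcycles:
  assumes "z \<in> kcycles n a (ideal_gen X) p"
  shows "kwedge n h z \<in> kcycles n a (ideal_gen (insert (lincomb n a h) X)) (Suc p)"
proof -
  have "kdiff n a (kwedge n h z) - lincomb n a h *\<^sub>v z = - kwedge n h (kdiff n a z)"
    by (simp add: algebra_simps flip: kdiff_kwedge_homotopy)
  also have "\<dots> \<in> funs_in (ideal_gen X)"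
    using assms
    by (intro funs.subspace_neg subspace_funs_in kwedge_funs_in) (auto simp: kcycles_def)
  finally show ?thesis
    using assms kwedge_kchain by (auto simp: kcycles_def intro: funs_in_ideal_gen_insertI)
qed

lemma kwedge_kboundaries:
  assumes "z \<in> kboundaries n a (ideal_gen X) p"
  shows "kwedge n h z \<in> kboundaries n a (ideal_gen (insert (lincomb n a h) X)) (Suc p)"
proof -
  let ?J' = "ideal_gen (insert (lincomb n a h) X)"
  obtain u where u: "u \<in> kchain n (Suc p)" "z - kdiff n a u \<in> funs_in (ideal_gen X)"
    using assms by (auto simp: kboundaries_def)
  have "kwedge n h z - kdiff n a (- kwedge n h u) - lincomb n a h *\<^sub>v u
      = kwedge n h (z - kdiff n a u)"
    by (simp add: kdiff.neg kwedge.diff flip: kdiff_kwedge_homotopy)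
  also have "\<dots> \<in> funs_in (ideal_gen X)"
    using u(2) by (intro kwedge_funs_in) auto
  finally have "kwedge n h z - kdiff n a (- kwedge n h u) \<in> funs_in ?J'"
    by (rule funs_in_ideal_gen_insertI)
  moreover have "- kwedge n h u \<in> kchain n (Suc (Suc p))"
    by (intro funs.subspace_neg subspace_kchain kwedge_kchain u)
  ultimately show ?thesis
    unfolding kboundaries_def by blast
qed

lemma kboundaries_of_kwedge:
  assumes nzd: "colon (ideal_gen X) {lincomb n a h} \<subseteq> ideal_gen X"
    and z: "z \<in> kcycles n a (ideal_gen X) p"
    and hz: "kwedge n h z \<in> kboundaries n a (ideal_gen (insert (lincomb n a h) X)) (Suc p)"
  shows "z \<in> kboundaries n a (ideal_gen X) p"
proof -
  let ?J = "ideal_gen X" and ?x = "lincomb n a h"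
  obtain u where u: "u \<in> kchain n (Suc (Suc p))"
      "kwedge n h z - kdiff n a u \<in> funs_in (ideal_gen (insert ?x X))"
    using hz by (auto simp: kboundaries_def)
  have "kwedge n h z - kdiff n a u \<in> kchain n (Suc p)"
    using z u(1) by (intro funs.subspace_diff subspace_kchain kwedge_kchain kdiff_kchain)
      (auto simp: kcycles_def)
  then obtain t where t: "t \<in> kchain n (Suc p)" "kwedge n h z - kdiff n a u - ?x *\<^sub>v t \<in> funs_in ?J"
    using u(2) by (rule kchain_ideal_gen_insertE)
  have "?x *\<^sub>v (z - kdiff n a t)
      = kdiff n a (kwedge n h z - kdiff n a u - ?x *\<^sub>v t) + kwedge n h (kdiff n a z)"
    by (simp add: kdiff.diff kdiff.scale kdiff_kdiff funs.scale_right_diff_distrib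
          flip: kdiff_kwedge_homotopy[of n a h z])
  also have "\<dots> \<in> funs_in ?J"
    using z t(2)
    by (auto simp: kcycles_def intro: funs.subspace_add subspace_funs_in kdiff_funs_in kwedge_funs_in)
  finally have "z - kdiff n a t \<in> funs_in ?J"
    by (rule funs_in_cancel_scale[OF nzd])
  with t(1) show ?thesis
    unfolding kboundaries_def by blast
qed

lemma ktorsion_free_descend:
  assumes "colon (ideal_gen X) {lincomb n a h} \<subseteq> ideal_gen X"
    and "ktorsion_free n a S (ideal_gen (insert (lincomb n a h) X)) (Suc p)"
  shows "ktorsion_free n a S (ideal_gen X) p"
  unfolding ktorsion_free_def
proof (intro ballI impI)
  let ?J' = "ideal_gen (insert (lincomb n a h) X)"
  fix z assume z: "z \<in> kcycles n a (ideal_gen X) p"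
    and ann: "\<forall>s\<in>S. s *\<^sub>v z \<in> kboundaries n a (ideal_gen X) p"
  have "s *\<^sub>v kwedge n h z \<in> kboundaries n a ?J' (Suc p)" if "s \<in> S" for s
    using kwedge_kboundaries[of "s *\<^sub>v z"] ann that by (simp add: kwedge.scale)
  then have "kwedge n h z \<in> kboundaries n a ?J' (Suc p)"
    using assms(2) kwedge_kcycles[OF z] by (simp add: ktorsion_free_def)
  with assms(1) z show "z \<in> kboundaries n a (ideal_gen X) p"
    by (rule kboundaries_of_kwedge)
qed

lemma ktorsion_free_descend_weakly_regular:
  assumes "weakly_regular xs" "set xs \<subseteq> ideal_gen (a ` {..<n})"
    and "ktorsion_free n a S (ideal_gen (set xs)) (p + length xs)"
  shows "ktorsion_free n a S {0} p"
  using assms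
proof (induction xs rule: rev_induct)
  case (snoc x xs)
  then obtain h where "x = lincomb n a h"
    by (auto simp: ideal_gen_image_eq_lincomb)
  with snoc.prems have "ktorsion_free n a S (ideal_gen (set xs)) (p + length xs)"
    by (intro ktorsion_free_descend[of "set xs" n a h]) (simp_all add: weakly_regular_snoc)
  with snoc show ?case
    by (simp add: weakly_regular_snoc)
qed simp

lemma kcycles_subset_kboundaries_insert:
  assumes nzd: "colon (ideal_gen X) {x} \<subseteq> ideal_gen X"
    and exact_p: "kcycles n a (ideal_gen X) p \<subseteq> kboundaries n a (ideal_gen X) p"
    and exact_Suc_p: "kcycles n a (ideal_gen X) (Suc p) \<subseteq> kboundaries n a (ideal_gen X) (Suc p)"
  shows "kcycles n a (ideal_gen (insert x X)) (Suc p)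
    \<subseteq> kboundaries n a (ideal_gen (insert x X)) (Suc p)"
proof
  let ?J = "ideal_gen X"
  fix z assume "z \<in> kcycles n a (ideal_gen (insert x X)) (Suc p)"
  then have z: "z \<in> kchain n (Suc p)" and dz: "kdiff n a z \<in> funs_in (ideal_gen (insert x X))"
    by (simp_all add: kcycles_def)
  obtain w where w: "w \<in> kchain n p" "kdiff n a z - x *\<^sub>v w \<in> funs_in ?J"
    using kdiff_kchain[OF z] dz by (rule kchain_ideal_gen_insertE)
  have "x *\<^sub>v kdiff n a w = - kdiff n a (kdiff n a z - x *\<^sub>v w)"
    by (simp add: kdiff.diff kdiff.scale kdiff_kdiff)
  also have "\<dots> \<in> funs_in ?J"
    using w(2) by (intro funs.subspace_neg subspace_funs_in kdiff_funs_in) auto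
  finally have "w \<in> kcycles n a ?J p"
    using w(1) funs_in_cancel_scale[OF nzd] by (simp add: kcycles_def)
  then obtain t where t: "t \<in> kchain n (Suc p)" "w - kdiff n a t \<in> funs_in ?J"
    using exact_p by (auto simp: kboundaries_def)
  have "kdiff n a (z - x *\<^sub>v t) = (kdiff n a z - x *\<^sub>v w) + x *\<^sub>v (w - kdiff n a t)"
    by (simp add: kdiff.diff kdiff.scale algebra_simps)
  also have "\<dots> \<in> funs_in ?J"
    using w(2) t(2) by (intro funs.subspace_add funs.subspace_scale subspace_funs_in) auto
  finally have "z - x *\<^sub>v t \<in> kcycles n a ?J (Suc p)"
    using z t(1)
    by (auto simp: kcycles_def intro: funs.subspace_diff funs.subspace_scale subspace_kchain)
  then obtain u where u: "u \<in> kchain n (Suc (Suc p))" "z - x *\<^sub>v t - kdiff n a u \<in> funs_in ?J"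
    using exact_Suc_p by (auto simp: kboundaries_def)
  have "z - kdiff n a u \<in> funs_in (ideal_gen (insert x X))"
    using u(2) by (intro funs_in_ideal_gen_insertI[of _ _ t]) (simp add: algebra_simps)
  with u(1) show "z \<in> kboundaries n a (ideal_gen (insert x X)) (Suc p)"
    unfolding kboundaries_def by blast
qed

lemma koszul_acyclic:
  assumes "weakly_regular ys" "0 < p"
  shows "kcycles (length ys) ((!) ys) {0} p \<subseteq> kboundaries (length ys) ((!) ys) {0} p"
proof -
  have "set ys = (!) ys ` {..<length ys}"
    by (auto simp: in_set_conv_nth)
  then have "set ys \<subseteq> ideal_gen ((!) ys ` {..<length ys})"
    using ideal.span_superset by metis
  moreover have "ktorsion_free (length ys) ((!) ys) {} (ideal_gen (set ys)) (p + length ys)"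
    unfolding ktorsion_free_empty using assms(2) by (intro kcycles_subset_kboundaries_above) auto
  ultimately have "ktorsion_free (length ys) ((!) ys) {} {0} p"
    by (rule ktorsion_free_descend_weakly_regular[OF assms(1)])
  then show ?thesis
    by (simp only: ktorsion_free_empty)
qed

lemma koszul_acyclic_mod_weakly_regular:
  assumes "weakly_regular ys" "weakly_regular xs" "length xs < p"
  shows "kcycles (length ys) ((!) ys) (ideal_gen (set xs)) p
    \<subseteq> kboundaries (length ys) ((!) ys) (ideal_gen (set xs)) p"
  using assms(2,3)
proof (induction xs arbitrary: p rule: rev_induct)
  case Nil
  then show ?case
    using koszul_acyclic[OF assms(1)] by simp
next
  case (snoc x xs)
  then obtain q where "p = Suc q" "length xs < q"
    by (cases p) auto
  with snoc show ?case
    by (simp add: weakly_regular_snoc kcycles_subset_kboundaries_insert)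
qed

text \<open>The annihilator of \<open>ys\<close> in \<open>A/(xs)\<close> is the top Koszul homology \<open>H\<^sub>n(ys; A/(xs))\<close>.\<close>
lemma colon_weakly_regular_subset:
  assumes "weakly_regular ys" "weakly_regular xs" "length xs < length ys"
  shows "colon (ideal_gen (set xs)) (set ys) \<subseteq> ideal_gen (set xs)"
proof
  let ?n = "length ys" and ?J = "ideal_gen (set xs)"
  fix u assume "u \<in> colon ?J (set ys)"
  then have ys_u: "ys ! i * u \<in> ?J" if "i < ?n" for i
    using that by (simp add: colon_def)
  define z where "z = 0({..<?n} := u)"
  have "kdiff ?n ((!) ys) z T \<in> ?J" for T
    unfolding kdiff_def
  proof (rule ideal.span_sum)
    fix i assume "i \<in> {..<?n}"
    then have "ys ! i * z (insert i T) \<in> ?J"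
      using ys_u by (simp add: z_def ideal.span_zero)
    from ideal.span_scale[OF this, of "ksign i T"]
    show "(if i \<in> T then 0 else ksign i T * ys ! i * z (insert i T)) \<in> ?J"
      by (simp add: ideal.span_zero mult.assoc)
  qed
  then have "z \<in> kcycles ?n ((!) ys) ?J ?n"
    by (auto simp: kcycles_def kchain_def funs_in_def z_def split: if_splits)
  then have "z \<in> funs_in ?J"
    using koszul_acyclic_mod_weakly_regular[OF assms] kboundaries_top[of ?n ?n] by blast
  then show "u \<in> ?J"
    by (auto simp: funs_in_def z_def split: if_splits dest: spec[of _ "{..<?n}"])
qed

lemma ktorsion_free_of_grade:
  assumes "n = p + k" "enat k \<le> grade (ideal_gen (a ` {..<n}))" "enat (Suc k) \<le> grade S"
  shows "ktorsion_free n a S {0} p"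
proof -
  obtain xs where xs: "length xs = k" "weakly_regular xs" "set xs \<subseteq> ideal_gen (a ` {..<n})"
    using assms(2) by (rule weakly_regular_of_grade)
  obtain ys where ys: "length ys = Suc k" "weakly_regular ys" "set ys \<subseteq> S"
    using assms(3) by (rule weakly_regular_of_grade)
  have "colon (ideal_gen (set xs)) S \<subseteq> colon (ideal_gen (set xs)) (set ys)"
    using ys(3) by (auto simp: colon_def)
  also have "\<dots> \<subseteq> ideal_gen (set xs)"
    using xs ys by (intro colon_weakly_regular_subset) auto
  finally have "ktorsion_free n a S (ideal_gen (set xs)) (p + length xs)"
    using assms(1) xs(1) by (intro ktorsion_free_top) auto
  then show ?thesis
    by (rule ktorsion_free_descend_weakly_regular[OF xs(2,3)])
qed

section \<open>Koszul syzygies\<close>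

lemma syzygies_eq_lincomb: "syzygies n a = {x \<in> freemod n. lincomb n a x = 0}"
  by (simp add: syzygies_def lincomb_def)

lemma subspace_syzygies: "funs.subspace (syzygies n a)"
  using funs.subspace_inter[OF subspace_freemod lincomb.subspace_kernel]
  by (simp add: syzygies_eq_lincomb Int_def)

lemma subspace_ideal_freemod: "is_ideal J \<Longrightarrow> funs.subspace (ideal_freemod J n)"
  by (simp add: ideal_freemod_def freemod_def funs.subspace_def is_ideal_def)

lemma koszul_syz_eq_diff: "koszul_syz a i j = 0(i := a j) - 0(j := a i)"
  by (simp add: koszul_syz_def fun_eq_iff)

lemma koszul_syzygies_eq_span:
  "koszul_syzygies n a = funs.span {koszul_syz a i j | i j. i < n \<and> j < n}"
  by (simp add: koszul_syzygies_def submod_gen_eq_span)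

lemma subspace_koszul_syzygies: "funs.subspace (koszul_syzygies n a)"
  by (simp add: koszul_syzygies_eq_span)

lemma koszul_syzygies_subset:
  "koszul_syzygies n a \<subseteq> syzygies n a \<inter> ideal_freemod (ideal_gen (a ` {..<n})) n"
  unfolding koszul_syzygies_eq_span
proof (rule funs.span_minimal)
  have "koszul_syz a i j \<in> syzygies n a \<inter> ideal_freemod (ideal_gen (a ` {..<n})) n"
    if "i < n" "j < n" for i j
  proof
    have "koszul_syz a i j \<in> freemod n"
      using that by (simp add: koszul_syz_eq_diff freemod_def)
    moreover have "lincomb n a (koszul_syz a i j) = 0"
      using that by (simp add: koszul_syz_eq_diff lincomb.diff lincomb_single)
    ultimately show "koszul_syz a i j \<in> syzygies n a"
      by (simp add: syzygies_eq_lincomb)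
    have "a k \<in> ideal_gen (a ` {..<n})" if "k < n" for k
      using that by (simp add: ideal.span_base)
    then show "koszul_syz a i j \<in> ideal_freemod (ideal_gen (a ` {..<n})) n"
      using that \<open>koszul_syz a i j \<in> freemod n\<close>
      by (simp add: ideal_freemod_def koszul_syz_eq_diff ideal.span_diff ideal.span_neg
          ideal.span_zero)
  qed
  then show "{koszul_syz a i j | i j. i < n \<and> j < n}
      \<subseteq> syzygies n a \<inter> ideal_freemod (ideal_gen (a ` {..<n})) n"
    by blast
  show "funs.subspace (syzygies n a \<inter> ideal_freemod (ideal_gen (a ` {..<n})) n)"
    by (intro funs.subspace_inter subspace_syzygies subspace_ideal_freemod) simp
qed

lemma lincomb_commutator_in_koszul_syzygies:
  assumes "u \<in> freemod n" "v \<in> freemod n"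
  shows "lincomb n a v *\<^sub>v u - lincomb n a u *\<^sub>v v \<in> koszul_syzygies n a"
proof -
  have "lincomb n a v *\<^sub>v u - lincomb n a u *\<^sub>v v
      = (\<Sum>i<n. \<Sum>j<n. (u i * v j) *\<^sub>v koszul_syz a i j)"
  proof
    fix k
    have "(\<Sum>i<n. \<Sum>j<n. u i * v j * (if k = i then a j else 0))
        = (\<Sum>i<n. if k = i then u k * lincomb n a v else 0)"
      by (intro sum.cong refl) (simp add: lincomb_def sum_distrib_left mult.assoc)
    also have "\<dots> = lincomb n a v * u k"
      using assms(1) by (simp add: freemod_def mult.commute)
    finally have "(\<Sum>i<n. \<Sum>j<n. u i * v j * (if k = i then a j else 0)) = lincomb n a v * u k" .
    moreover have "(\<Sum>i<n. \<Sum>j<n. u i * v j * (if k = j then a i else 0)) = lincomb n a u * v k"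
      using assms(2)
      by (cases "k < n")
         (simp_all add: if_distrib[of "\<lambda>c. _ * c"] freemod_def lincomb_def sum_distrib_left mult_ac
            cong: if_cong)
    ultimately show "(lincomb n a v *\<^sub>v u - lincomb n a u *\<^sub>v v) k
        = (\<Sum>i<n. \<Sum>j<n. (u i * v j) *\<^sub>v koszul_syz a i j) k"
      by (simp add: koszul_syz_def right_diff_distrib sum_subtractf)
  qed
  also have "\<dots> \<in> koszul_syzygies n a"
    unfolding koszul_syzygies_eq_span by (intro funs.span_sum funs.span_scale funs.span_base) auto
  finally show ?thesis .
qed

lemma ideal_scale_syzygies:
  assumes "x \<in> syzygies n a" "y \<in> ideal_gen (a ` {..<n})"
  shows "y *\<^sub>v x \<in> koszul_syzygies n a"
proof -
  obtain v where "v \<in> freemod n" "y = lincomb n a v"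
    using assms(2) by (auto simp: ideal_gen_image_eq_lincomb)
  then show ?thesis
    using lincomb_commutator_in_koszul_syzygies[of x n v a] assms(1)
    by (simp add: syzygies_eq_lincomb)
qed

lemma kdiff_unit_pair:
  assumes "i < j" "j < n"
  shows "kdiff n a (0({i, j} := 1)) {k} = koszul_syz a j i k"
proof -
  have "kdiff n a (0({i, j} := 1)) {k}
      = (\<Sum>l<n. (if l = i then if k = j then a i else 0 else 0)
             + (if l = j then if k = i then - a j else 0 else 0))"
    unfolding kdiff_def using assms(1)
    by (intro sum.cong refl) (auto simp: doubleton_eq_iff ksign_insert)
  also have "\<dots> = koszul_syz a j i k"
    using assms by (simp add: sum.distrib koszul_syz_def)
  finally show ?thesis .
qed

lemma koszul_syzygies_eq_span_less:
  "koszul_syzygies n a = funs.span {koszul_syz a j i | i j. i < j \<and> j < n}" (is "_ = funs.span ?S")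
proof
  have "koszul_syz a i j \<in> funs.span ?S" if "i < n" "j < n" for i j
  proof (cases i j rule: linorder_cases)
    case less
    have "koszul_syz a i j = - koszul_syz a j i"
      by (simp add: koszul_syz_eq_diff)
    also have "\<dots> \<in> funs.span ?S"
      using less that(2) by (intro funs.span_neg funs.span_base) auto
    finally show ?thesis .
  next
    case equal
    then show ?thesis
      by (simp add: koszul_syz_eq_diff funs.span_zero)
  next
    case greater
    with that show ?thesis
      by (intro funs.span_base) auto
  qed
  then show "koszul_syzygies n a \<subseteq> funs.span ?S"
    unfolding koszul_syzygies_eq_span by (intro funs.span_minimal) auto
  show "funs.span ?S \<subseteq> koszul_syzygies n a"
    unfolding koszul_syzygies_eq_span by (rule funs.span_mono) force
qed

lemma koszul_syzygies_eq_kdiff_image: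
  "koszul_syzygies n a = (\<lambda>u k. kdiff n a u {k}) ` kchain n 2"
proof -
  let ?d = "\<lambda>u k. kdiff n a u {k}" and ?e = "\<lambda>T. 0(T := 1)"
  interpret d: module_hom fun_scale fun_scale ?d
    by standard (simp_all add: fun_eq_iff kdiff.add kdiff.scale)
  have "\<exists>i j. T = {i, j} \<and> i < j \<and> j < n" if "T \<subseteq> {..<n}" "card T = 2" for T
  proof -
    obtain i j where "T = {i, j}" "i < j"
      using \<open>card T = 2\<close> by (metis card_2_iff insert_commute linorder_neqE_nat)
    with \<open>T \<subseteq> {..<n}\<close> show ?thesis
      by auto
  qed
  then have pairs: "{T. T \<subseteq> {..<n} \<and> card T = 2} = {{i, j} | i j. i < j \<and> j < n}"
    by auto
  have unit_pair: "?d (?e {i, j}) = koszul_syz a j i" if "i < j" "j < n" for i j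
    by (simp add: fun_eq_iff kdiff_unit_pair[OF that])
  have "?d ` ?e ` {T. T \<subseteq> {..<n} \<and> card T = 2} = {?d (?e {i, j}) | i j. i < j \<and> j < n}"
    unfolding pairs by blast
  also have "\<dots> = {koszul_syz a j i | i j. i < j \<and> j < n}"
    using unit_pair by (intro Collect_cong ex_cong1) auto
  finally show ?thesis
    by (simp only: koszul_syzygies_eq_span_less kchain_eq_span d.span_image[symmetric])
qed

definition chain_of :: "(nat \<Rightarrow> 'a::comm_ring_1) \<Rightarrow> nat set \<Rightarrow> 'a" where
  "chain_of x T = (if is_singleton T then x (the_elem T) else 0)"

lemma chain_of_singleton: "chain_of x {k} = x k"
  by (simp add: chain_of_def)

lemma chain_of_scale: "chain_of (c *\<^sub>v x) = c *\<^sub>v chain_of x"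
  by (simp add: chain_of_def fun_eq_iff)

lemma chain_of_coefficients: "z \<in> kchain n 1 \<Longrightarrow> chain_of (\<lambda>k. z {k}) = z"
  by (auto simp: fun_eq_iff chain_of_def kchain_def is_singleton_def card_1_singleton_iff)

lemma chain_of_in_kcycles:
  assumes "x \<in> syzygies n a"
  shows "chain_of x \<in> kcycles n a {0} 1"
proof -
  have "chain_of x \<in> kchain n 1"
    using assms by (auto simp: kchain_def chain_of_def syzygies_def freemod_def is_singleton_def
        not_le[symmetric])
  then have "kdiff n a (chain_of x) \<in> kchain n 0"
    by (intro kdiff_kchain) simp
  moreover have "kdiff n a (chain_of x) {} = lincomb n a x"
    by (simp add: kdiff_def lincomb_def chain_of_singleton mult.commute)
  ultimately have "kdiff n a (chain_of x) = 0"
    using assms by (auto simp: fun_eq_iff kchain_def syzygies_eq_lincomb dest!: finite_subset)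
  with \<open>chain_of x \<in> kchain n 1\<close> show ?thesis
    by (simp add: kcycles_def funs_in_zero)
qed

lemma koszul_syzygies_iff_kboundaries:
  "x \<in> koszul_syzygies n a \<longleftrightarrow> chain_of x \<in> kboundaries n a {0} 1"
proof -
  have "x = (\<lambda>k. kdiff n a u {k}) \<longleftrightarrow> chain_of x = kdiff n a u" if "u \<in> kchain n (Suc 1)" for u
    using chain_of_coefficients[OF kdiff_kchain[OF that]] chain_of_singleton by metis
  then show ?thesis
    unfolding koszul_syzygies_eq_kdiff_image kboundaries_zero numeral_2_eq_2 One_nat_def by blast
qed

lemma koszul_syzygies_torsion_free:
  assumes "ktorsion_free n a S {0} 1" "z \<in> syzygies n a"
    and "\<And>s. s \<in> S \<Longrightarrow> s *\<^sub>v z \<in> koszul_syzygies n a"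
  shows "z \<in> koszul_syzygies n a"
  using assms chain_of_in_kcycles[OF assms(2)]
  by (simp add: ktorsion_free_def koszul_syzygies_iff_kboundaries chain_of_scale)

lemma koszul_syzygies_saturated:
  assumes "ktorsion_free n a m {0} 1" "z \<in> syzygies n a"
    and "\<And>y. y \<in> ideal_pow m k \<Longrightarrow> y *\<^sub>v z \<in> koszul_syzygies n a"
  shows "z \<in> koszul_syzygies n a"
  using assms(2,3)
proof (induction k arbitrary: z)
  case 0
  from "0.prems"(2)[of 1] show ?case
    by simp
next
  case (Suc k)
  show ?case
  proof (rule Suc.IH[OF Suc.prems(1)])
    fix y assume y: "y \<in> ideal_pow m k"
    show "y *\<^sub>v z \<in> koszul_syzygies n a"
    proof (rule koszul_syzygies_torsion_free[OF assms(1)])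
      show "y *\<^sub>v z \<in> syzygies n a"
        using Suc.prems(1) by (intro funs.subspace_scale subspace_syzygies)
      fix s assume "s \<in> m"
      with y have "s * y \<in> ideal_pow m (Suc k)"
        by (auto simp: ideal_mult_def intro: ideal.span_base)
      then have "(s * y) *\<^sub>v z \<in> koszul_syzygies n a"
        by (rule Suc.prems(2))
      then show "s *\<^sub>v y *\<^sub>v z \<in> koszul_syzygies n a"
        by simp
    qed
  qed
qed

lemma TF_syzygies_subset_koszul_syzygies:
  fixes a :: "nat \<Rightarrow> 'a::comm_ring_1" and n :: nat
  defines "I \<equiv> ideal_gen (a ` {..<n})"
  assumes "ktorsion_free n a m {0} 1"
    and koszul: "syzygies n a \<inter> ideal_freemod I n \<subseteq> koszul_syzygies n a"
  shows "syzygies n a \<inter> ideal_freemod (TF m I) n \<subseteq> koszul_syzygies n a"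
proof
  fix z assume z: "z \<in> syzygies n a \<inter> ideal_freemod (TF m I) n"
  then have "z i \<in> TF m I" if "i \<in> {..<n}" for i
    using that by (simp add: ideal_freemod_def)
  then obtain k where k: "\<And>i y. i \<in> {..<n} \<Longrightarrow> y \<in> ideal_pow m k \<Longrightarrow> z i * y \<in> I"
    using TF_common_exponent[OF finite_lessThan] by metis
  show "z \<in> koszul_syzygies n a"
  proof (rule koszul_syzygies_saturated[OF assms(2)])
    fix y assume "y \<in> ideal_pow m k"
    then have "y *\<^sub>v z \<in> syzygies n a \<inter> ideal_freemod I n"
      using z k funs.subspace_scale[OF subspace_syzygies]
      by (auto simp: ideal_freemod_def freemod_def mult.commute)
    with koszul show "y *\<^sub>v z \<in> koszul_syzygies n a"
      by blast
  qed (use z in simp)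
qed

section \<open>The symmetric square\<close>

definition formal_eval :: "('a \<Rightarrow> 'a \<Rightarrow> 'b::comm_ring_1) \<Rightarrow> ('a \<times> 'a \<Rightarrow> int) \<Rightarrow> 'b" where
  "formal_eval \<phi> f = (\<Sum>p | f p \<noteq> 0. of_int (f p) * \<phi> (fst p) (snd p))"

lemma span_fsym: "funs.span (fsym ` X) = {f. finite {p. f p \<noteq> 0} \<and> {p. f p \<noteq> 0} \<subseteq> X}"
proof -
  have fsym_eq: "fsym = (\<lambda>p. 0(p := 1))"
    by (simp add: fsym_def fun_eq_iff)
  show ?thesis
    unfolding fsym_eq span_unit_functions by auto
qed

lemma formal_eval_zero [simp]: "formal_eval \<phi> 0 = 0"
  by (simp add: formal_eval_def)

lemma formal_eval_fsym [simp]: "formal_eval \<phi> (fsym (x, y)) = \<phi> x y"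
  by (simp add: formal_eval_def fsym_def)

lemma formal_eval_uminus: "formal_eval \<phi> (- f) = - formal_eval \<phi> f"
  by (simp add: formal_eval_def sum_negf)

lemma formal_eval_add:
  assumes "f \<in> funs.span (range fsym)" "g \<in> funs.span (range fsym)"
  shows "formal_eval \<phi> (f + g) = formal_eval \<phi> f + formal_eval \<phi> g"
proof -
  let ?F = "{p. f p \<noteq> 0} \<union> {p. g p \<noteq> 0}"
  have "formal_eval \<phi> h = (\<Sum>p\<in>?F. of_int (h p) * \<phi> (fst p) (snd p))" if "h \<in> {f, g, f + g}" for h
    unfolding formal_eval_def
    by (rule sum.mono_neutral_left) (use assms that in \<open>auto simp: span_fsym\<close>)
  then show ?thesis
    by (simp add: sum.distrib distrib_right)
qed

lemma formal_eval_diff: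
  assumes "f \<in> funs.span (range fsym)" "g \<in> funs.span (range fsym)"
  shows "formal_eval \<phi> (f - g) = formal_eval \<phi> f - formal_eval \<phi> g"
  using formal_eval_add[OF assms(1) funs.span_neg[OF assms(2)], of \<phi>]
  by (simp add: formal_eval_uminus)

lemma formal_eval_sum:
  assumes "\<And>i. i \<in> F \<Longrightarrow> f i \<in> funs.span (range fsym)"
  shows "formal_eval \<phi> (\<Sum>i\<in>F. f i) = (\<Sum>i\<in>F. formal_eval \<phi> (f i))"
  using assms
  by (induction F rule: infinite_finite_induct) (simp_all add: formal_eval_add funs.span_sum)

lemma fsym_in_span [simp]: "fsym p \<in> funs.span (range fsym)"
  by (simp add: funs.span_base)

lemma sym2_rel_subset_span: "sym2_rel I \<subseteq> funs.span (range fsym)"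
proof
  fix f assume "f \<in> sym2_rel I"
  then show "f \<in> funs.span (range fsym)"
  proof induction
    case zero
    show ?case
      using funs.span_zero[of "range fsym"] unfolding zero_fun_def .
  qed (intro funs.span_add funs.span_neg funs.span_diff fsym_in_span; assumption)+
qed

lemma formal_eval_fsym_diff:
  "formal_eval \<phi> (fsym (x, y) - fsym (x', y')) = \<phi> x y - \<phi> x' y'"
  by (simp add: formal_eval_diff)

lemma formal_eval_fsym_diff_diff:
  "formal_eval \<phi> (fsym (x, y) - fsym (x', y') - fsym (x'', y'')) = \<phi> x y - \<phi> x' y' - \<phi> x'' y''"
  by (simp add: formal_eval_diff funs.span_diff)

lemma formal_eval_sym2_rel:
  fixes \<phi> :: "'a::comm_ring_1 \<Rightarrow> 'a \<Rightarrow> 'b::comm_ring_1"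
  assumes "f \<in> sym2_rel I"
    and H_zero: "0 \<in> H" and H_diff: "\<And>u v. u \<in> H \<Longrightarrow> v \<in> H \<Longrightarrow> u - v \<in> H"
    and add_left: "\<And>x x' y. x \<in> I \<Longrightarrow> x' \<in> I \<Longrightarrow> y \<in> I \<Longrightarrow> \<phi> (x + x') y - \<phi> x y - \<phi> x' y \<in> H"
    and add_right: "\<And>x y y'. x \<in> I \<Longrightarrow> y \<in> I \<Longrightarrow> y' \<in> I \<Longrightarrow> \<phi> x (y + y') - \<phi> x y - \<phi> x y' \<in> H"
    and scale: "\<And>r x y. x \<in> I \<Longrightarrow> y \<in> I \<Longrightarrow> \<phi> (r * x) y - \<phi> x (r * y) \<in> H"
    and commute: "\<And>x y. x \<in> I \<Longrightarrow> y \<in> I \<Longrightarrow> \<phi> x y - \<phi> y x \<in> H"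
  shows "formal_eval \<phi> f \<in> H"
  using assms(1)
proof induction
  case zero
  show ?case
    using H_zero by (simp add: formal_eval_def)
next
  case (neg u)
  from H_diff[OF H_zero neg.IH] show ?case
    by (simp only: formal_eval_uminus diff_0)
next
  case (add u v)
  have "u \<in> funs.span (range fsym)" "v \<in> funs.span (range fsym)"
    using add.hyps sym2_rel_subset_span by blast+
  then have "formal_eval \<phi> (u + v) = formal_eval \<phi> u - (0 - formal_eval \<phi> v)"
    by (simp add: formal_eval_add)
  also have "\<dots> \<in> H"
    by (intro H_diff H_zero add.IH)
  finally show ?case .
qed (simp_all only: formal_eval_fsym_diff formal_eval_fsym_diff_diff add_left add_right
    scale commute)

lemma syzygetic_iff_formal_eval:
  "syzygetic I \<longleftrightarrow> (\<forall>f\<in>funs.span (fsym ` (I \<times> I)). formal_eval (*) f = 0 \<longrightarrow> f \<in> sym2_rel I)"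
  by (auto simp: syzygetic_def span_fsym formal_eval_def mult.assoc)

lemma int_subspaceI:
  fixes H :: "('i \<Rightarrow> int) set"
  assumes "0 \<in> H" and diff: "\<And>u v. u \<in> H \<Longrightarrow> v \<in> H \<Longrightarrow> u - v \<in> H"
  shows "funs.subspace H"
proof (rule funs.subspaceI)
  show add: "u + v \<in> H" if "u \<in> H" "v \<in> H" for u v
    using diff[OF that(1) diff[OF assms(1) that(2)]] by simp
  show "k *\<^sub>v u \<in> H" if "u \<in> H" for k u
  proof (induction k rule: int_induct[where k = 0])
    case base
    show ?case
      using assms(1) unfolding funs.scale_zero_left .
  next
    case (step1 k)
    from add[OF step1.IH that] show ?case
      unfolding funs.scale_left_distrib funs.scale_one .
  next
    case (step2 k)
    from diff[OF step2.IH that] show ?case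
      unfolding funs.scale_left_diff_distrib funs.scale_one .
  qed
qed fact

lemma subspace_sym2_rel: "funs.subspace (sym2_rel I)"
proof (rule int_subspaceI)
  show "0 \<in> sym2_rel I"
    using sym2_rel.zero by (simp add: zero_fun_def)
  show "u - v \<in> sym2_rel I" if "u \<in> sym2_rel I" "v \<in> sym2_rel I" for u v
    using sym2_rel.add[OF that(1) sym2_rel.neg[OF that(2)]] by simp
qed

definition sym2_eq :: "'a::comm_ring_1 set \<Rightarrow> ('a \<times> 'a \<Rightarrow> int) \<Rightarrow> ('a \<times> 'a \<Rightarrow> int) \<Rightarrow> bool" where
  "sym2_eq I u v \<longleftrightarrow> u - v \<in> sym2_rel I"

lemma sym2_eq_zero_iff: "sym2_eq I u 0 \<longleftrightarrow> u \<in> sym2_rel I"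
  by (simp add: sym2_eq_def)

lemma sym2_eq_refl: "sym2_eq I u u"
  using funs.subspace_0[OF subspace_sym2_rel] by (simp add: sym2_eq_def)

lemma sym2_eq_sym: "sym2_eq I u v \<Longrightarrow> sym2_eq I v u"
  using funs.subspace_neg[OF subspace_sym2_rel, of "u - v"] by (simp add: sym2_eq_def)

lemma sym2_eq_trans [trans]: "sym2_eq I u v \<Longrightarrow> sym2_eq I v w \<Longrightarrow> sym2_eq I u w"
  using funs.subspace_add[OF subspace_sym2_rel, of "u - v" I "v - w"] by (simp add: sym2_eq_def)

lemma sym2_eq_add: "sym2_eq I u v \<Longrightarrow> sym2_eq I u' v' \<Longrightarrow> sym2_eq I (u + u') (v + v')"
  using funs.subspace_add[OF subspace_sym2_rel, of "u - v" I "u' - v'"]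
  by (simp add: sym2_eq_def algebra_simps)

lemma sym2_eq_diff: "sym2_eq I u v \<Longrightarrow> sym2_eq I u' v' \<Longrightarrow> sym2_eq I (u - u') (v - v')"
  using funs.subspace_diff[OF subspace_sym2_rel, of "u - v" I "u' - v'"]
  by (simp add: sym2_eq_def algebra_simps)

lemma sym2_eq_sum: "(\<And>i. i \<in> F \<Longrightarrow> sym2_eq I (f i) (g i)) \<Longrightarrow> sym2_eq I (\<Sum>i\<in>F. f i) (\<Sum>i\<in>F. g i)"
  using funs.subspace_sum[OF subspace_sym2_rel, of F "\<lambda>i. f i - g i" I]
  by (simp add: sym2_eq_def sum_subtractf)

lemma sym2_eq_fsym_add_left:
  "x \<in> I \<Longrightarrow> x' \<in> I \<Longrightarrow> y \<in> I \<Longrightarrow> sym2_eq I (fsym (x + x', y)) (fsym (x, y) + fsym (x', y))"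
  using sym2_rel.addl[of x I x' y] by (simp add: sym2_eq_def diff_diff_eq)

lemma sym2_eq_fsym_add_right:
  "x \<in> I \<Longrightarrow> y \<in> I \<Longrightarrow> y' \<in> I \<Longrightarrow> sym2_eq I (fsym (x, y + y')) (fsym (x, y) + fsym (x, y'))"
  using sym2_rel.addr[of x I y y'] by (simp add: sym2_eq_def diff_diff_eq)

lemma sym2_eq_fsym_scale: "x \<in> I \<Longrightarrow> y \<in> I \<Longrightarrow> sym2_eq I (fsym (r * x, y)) (fsym (x, r * y))"
  by (simp add: sym2_eq_def sym2_rel.scal)

lemma sym2_eq_fsym_commute: "x \<in> I \<Longrightarrow> y \<in> I \<Longrightarrow> sym2_eq I (fsym (x, y)) (fsym (y, x))"
  by (simp add: sym2_eq_def sym2_rel.symm)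

lemma sym2_eq_fsym_zero_left: "is_ideal I \<Longrightarrow> y \<in> I \<Longrightarrow> sym2_eq I (fsym (0, y)) 0"
  using sym2_eq_diff[OF sym2_eq_fsym_add_left[of 0 I 0 y] sym2_eq_refl[of I "fsym (0, y)"]]
  by (auto simp: ideal.subspace_0 intro: sym2_eq_sym)

lemma sym2_eq_fsym_zero_right:
  assumes "is_ideal I" "x \<in> I"
  shows "sym2_eq I (fsym (x, 0)) 0"
  using sym2_eq_trans[OF sym2_eq_fsym_commute sym2_eq_fsym_zero_left] assms ideal.subspace_0
  by metis

text \<open>On coefficient vectors \<open>b\<close> with entries in \<open>I = (a\<^sub>0, \<dots>, a\<^bsub>n-1\<^esub>)\<close> this is the map
  \<open>I A\<^sup>n \<rightarrow> Sym\<^sup>2(I)\<close> whose kernel is \<open>B\<^sub>1\<close>.\<close>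
definition sym2_comb :: "nat \<Rightarrow> (nat \<Rightarrow> 'a) \<Rightarrow> (nat \<Rightarrow> 'a) \<Rightarrow> 'a \<times> 'a \<Rightarrow> int" where
  "sym2_comb n a b = (\<Sum>i<n. fsym (a i, b i))"

lemma formal_eval_sym2_comb: "formal_eval \<phi> (sym2_comb n a b) = (\<Sum>i<n. \<phi> (a i) (b i))"
  by (simp add: sym2_comb_def formal_eval_sum)

lemma sym2_comb_in_span:
  assumes "a ` {..<n} \<subseteq> I" "b \<in> ideal_freemod I n"
  shows "sym2_comb n a b \<in> funs.span (fsym ` (I \<times> I))"
  unfolding sym2_comb_def using assms
  by (intro funs.span_sum funs.span_base) (auto simp: ideal_freemod_def)

lemma sym2_comb_add:
  assumes "a ` {..<n} \<subseteq> I" "b \<in> ideal_freemod I n" "c \<in> ideal_freemod I n"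
  shows "sym2_eq I (sym2_comb n a (b + c)) (sym2_comb n a b + sym2_comb n a c)"
proof -
  have "sym2_eq I (fsym (a i, (b + c) i)) (fsym (a i, b i) + fsym (a i, c i))" if "i < n" for i
    using assms that by (auto simp: ideal_freemod_def intro: sym2_eq_fsym_add_right)
  then show ?thesis
    unfolding sym2_comb_def sum.distrib[symmetric] by (intro sym2_eq_sum) simp
qed

lemma sym2_comb_diff:
  assumes "is_ideal I" "a ` {..<n} \<subseteq> I" "b \<in> ideal_freemod I n" "c \<in> ideal_freemod I n"
  shows "sym2_eq I (sym2_comb n a (b - c)) (sym2_comb n a b - sym2_comb n a c)"
proof -
  have "sym2_eq I (sym2_comb n a (b - c + c)) (sym2_comb n a (b - c) + sym2_comb n a c)"
    using assms by (intro sym2_comb_add funs.subspace_diff subspace_ideal_freemod)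
  from sym2_eq_diff[OF sym2_eq_sym[OF this] sym2_eq_refl, of "sym2_comb n a c"] show ?thesis
    by simp
qed

lemma sym2_comb_zero:
  assumes "is_ideal I" "a ` {..<n} \<subseteq> I"
  shows "sym2_eq I (sym2_comb n a 0) 0"
  using sym2_comb_diff[OF assms, of 0 0] funs.subspace_0[OF subspace_ideal_freemod[OF assms(1)]]
  by simp

lemma sym2_comb_single:
  assumes "is_ideal I" "a ` {..<n} \<subseteq> I" "i < n" "y \<in> I"
  shows "sym2_eq I (sym2_comb n a (0(i := y))) (fsym (a i, y))"
proof -
  have "sym2_eq I (\<Sum>k<n. fsym (a k, (0(i := y)) k)) (\<Sum>k<n. if k = i then fsym (a i, y) else 0)"
    using assms by (intro sym2_eq_sum) (auto simp: sym2_eq_refl sym2_eq_fsym_zero_right)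
  with assms(3) show ?thesis
    by (simp add: sym2_comb_def)
qed

lemma sym2_comb_koszul_syz:
  assumes "is_ideal I" "a ` {..<n} \<subseteq> I" "i < n" "j < n"
  shows "sym2_eq I (sym2_comb n a (c *\<^sub>v koszul_syz a i j)) 0"
proof -
  have in_I: "a i \<in> I" "a j \<in> I" "c * a i \<in> I" "c * a j \<in> I"
    using assms ideal.subspace_scale by auto
  have "c *\<^sub>v koszul_syz a i j = 0(i := c * a j) - 0(j := c * a i)"
    by (simp add: koszul_syz_eq_diff fun_eq_iff)
  moreover have "0(i := c * a j) \<in> ideal_freemod I n" "0(j := c * a i) \<in> ideal_freemod I n"
    using assms in_I by (simp_all add: ideal_freemod_def freemod_def ideal.subspace_0)
  ultimately have "sym2_eq I (sym2_comb n a (c *\<^sub>v koszul_syz a i j))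
      (sym2_comb n a (0(i := c * a j)) - sym2_comb n a (0(j := c * a i)))"
    using assms by (simp add: sym2_comb_diff)
  also have "sym2_eq I \<dots> (fsym (a i, c * a j) - fsym (a j, c * a i))"
    using assms in_I by (intro sym2_eq_diff sym2_comb_single)
  also have "sym2_eq I \<dots> (fsym (a i, c * a j) - fsym (a i, c * a j))"
  proof (intro sym2_eq_diff sym2_eq_refl)
    have "sym2_eq I (fsym (a j, c * a i)) (fsym (c * a i, a j))"
      using in_I by (intro sym2_eq_fsym_commute)
    also have "sym2_eq I \<dots> (fsym (a i, c * a j))"
      using in_I by (intro sym2_eq_fsym_scale)
    finally show "sym2_eq I (fsym (a j, c * a i)) (fsym (a i, c * a j))" .
  qed
  finally show ?thesis
    by simp
qed

lemma sym2_comb_koszul_syzygies: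
  fixes a :: "nat \<Rightarrow> 'a::comm_ring_1" and n :: nat
  defines "I \<equiv> ideal_gen (a ` {..<n})"
  assumes "b \<in> koszul_syzygies n a"
  shows "sym2_eq I (sym2_comb n a b) 0"
proof -
  have I: "is_ideal I" "a ` {..<n} \<subseteq> I"
    by (simp_all add: I_def ideal.span_superset)
  have "b \<in> ideal_freemod I n \<and> sym2_eq I (sym2_comb n a b) 0"
    using assms(2) unfolding koszul_syzygies_eq_span
  proof (induction rule: funs.span_induct_alt)
    case base
    show ?case
      using sym2_comb_zero[OF I] funs.subspace_0[OF subspace_ideal_freemod[OF I(1)]] by blast
  next
    case (step c v b)
    then obtain i j where v: "v = koszul_syz a i j" "i < n" "j < n"
      by blast
    then have "v \<in> koszul_syzygies n a"
      unfolding koszul_syzygies_eq_span by (auto intro: funs.span_base)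
    then have cv_free: "c *\<^sub>v v \<in> ideal_freemod I n"
      using koszul_syzygies_subset[of n a] I(1)
      by (auto simp: I_def intro: funs.subspace_scale subspace_ideal_freemod)
    have "sym2_eq I (sym2_comb n a (c *\<^sub>v v + b)) (sym2_comb n a (c *\<^sub>v v) + sym2_comb n a b)"
      using I(2) cv_free step by (intro sym2_comb_add) auto
    also have "sym2_eq I \<dots> (0 + 0)"
    proof (rule sym2_eq_add)
      show "sym2_eq I (sym2_comb n a (c *\<^sub>v v)) 0"
        unfolding v(1) using I v(2,3) by (rule sym2_comb_koszul_syz)
      show "sym2_eq I (sym2_comb n a b) 0"
        using step.IH by blast
    qed
    finally show ?case
      using funs.subspace_add[OF subspace_ideal_freemod[OF I(1)] cv_free] step.IH
      unfolding add_0 by blast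
  qed
  then show ?thesis
    by blast
qed

definition sym2_comb_range :: "'a::comm_ring_1 set \<Rightarrow> nat \<Rightarrow> (nat \<Rightarrow> 'a) \<Rightarrow> ('a \<times> 'a \<Rightarrow> int) set" where
  "sym2_comb_range I n a = {f. \<exists>b\<in>ideal_freemod I n. sym2_eq I f (sym2_comb n a b)}"

lemma sym2_comb_range_cong: "sym2_eq I f g \<Longrightarrow> g \<in> sym2_comb_range I n a \<Longrightarrow> f \<in> sym2_comb_range I n a"
  unfolding sym2_comb_range_def using sym2_eq_trans by blast

lemma subspace_sym2_comb_range:
  assumes I: "is_ideal I" "a ` {..<n} \<subseteq> I"
  shows "funs.subspace (sym2_comb_range I n a)"
proof (rule int_subspaceI)
  note free = subspace_ideal_freemod[OF I(1), of n]
  show "0 \<in> sym2_comb_range I n a"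
    using sym2_eq_sym[OF sym2_comb_zero[OF I]] funs.subspace_0[OF free]
    by (auto simp: sym2_comb_range_def)
  fix f g assume "f \<in> sym2_comb_range I n a" "g \<in> sym2_comb_range I n a"
  then obtain b c where b: "b \<in> ideal_freemod I n" "sym2_eq I f (sym2_comb n a b)"
    and c: "c \<in> ideal_freemod I n" "sym2_eq I g (sym2_comb n a c)"
    by (auto simp: sym2_comb_range_def)
  have "sym2_eq I (f - g) (sym2_comb n a b - sym2_comb n a c)"
    using b c by (intro sym2_eq_diff)
  also have "sym2_eq I \<dots> (sym2_comb n a (b - c))"
    using I b c by (intro sym2_eq_sym[OF sym2_comb_diff])
  finally show "f - g \<in> sym2_comb_range I n a"
    using funs.subspace_diff[OF free b(1) c(1)] by (auto simp: sym2_comb_range_def)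
qed

lemma fsym_in_sym2_comb_range:
  fixes a :: "nat \<Rightarrow> 'a::comm_ring_1" and n :: nat
  defines "I \<equiv> ideal_gen (a ` {..<n})"
  assumes "x \<in> I" "y \<in> I"
  shows "fsym (x, y) \<in> sym2_comb_range I n a"
proof -
  have I: "is_ideal I" "a ` {..<n} \<subseteq> I"
    by (simp_all add: I_def ideal.span_superset)
  note range = subspace_sym2_comb_range[OF I]
  have "is_ideal {x \<in> I. \<forall>y\<in>I. fsym (x, y) \<in> sym2_comb_range I n a}" (is "is_ideal ?R")
  proof (rule ideal.subspaceI)
    show "0 \<in> ?R"
      using I(1) sym2_comb_range_cong[OF sym2_eq_fsym_zero_left] funs.subspace_0[OF range]
      by (auto intro: ideal.subspace_0)
    show "x + x' \<in> ?R" if "x \<in> ?R" "x' \<in> ?R" for x x'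
      using that I(1)
      by (auto intro: ideal.subspace_add funs.subspace_add[OF range]
          sym2_comb_range_cong[OF sym2_eq_fsym_add_left])
    show "c * x \<in> ?R" if "x \<in> ?R" for c x
      using that I(1)
      by (auto intro: ideal.subspace_scale sym2_comb_range_cong[OF sym2_eq_fsym_scale])
  qed
  moreover have "fsym (a i, y) \<in> sym2_comb_range I n a" if "i < n" "y \<in> I" for i y
  proof -
    have "0(i := y) \<in> ideal_freemod I n"
      using that I(1) by (auto simp: ideal_freemod_def freemod_def ideal.subspace_0)
    then show ?thesis
      using sym2_eq_sym[OF sym2_comb_single[OF I that]] by (auto simp: sym2_comb_range_def)
  qed
  then have "a ` {..<n} \<subseteq> ?R"
    using I(2) by auto
  ultimately have "ideal_gen (a ` {..<n}) \<subseteq> ?R"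
    by (intro ideal.span_minimal)
  with assms show ?thesis
    by (auto simp: I_def)
qed

lemma span_fsym_subset_sym2_comb_range:
  fixes a :: "nat \<Rightarrow> 'a::comm_ring_1" and n :: nat
  defines "I \<equiv> ideal_gen (a ` {..<n})"
  shows "funs.span (fsym ` (I \<times> I)) \<subseteq> sym2_comb_range I n a"
proof (rule funs.span_minimal)
  show "fsym ` (I \<times> I) \<subseteq> sym2_comb_range I n a"
    by (auto simp: I_def fsym_in_sym2_comb_range)
  show "funs.subspace (sym2_comb_range I n a)"
    by (intro subspace_sym2_comb_range) (simp_all add: I_def ideal.span_superset)
qed

text \<open>Modulo \<open>B\<^sub>1\<close> the pairing \<open>x y \<mapsto> r(x) y\<close> does not depend on the choice of the coefficient
  vectors \<open>r(x)\<close>, because \<open>I Z\<^sub>1 \<subseteq> B\<^sub>1\<close>.\<close>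
lemma formal_eval_coefficients_sym2_rel:
  fixes a :: "nat \<Rightarrow> 'a::comm_ring_1" and n :: nat
  defines "I \<equiv> ideal_gen (a ` {..<n})"
  assumes r: "\<And>x. x \<in> I \<Longrightarrow> r x \<in> freemod n" "\<And>x. x \<in> I \<Longrightarrow> lincomb n a (r x) = x"
    and "f \<in> sym2_rel I"
  shows "formal_eval (\<lambda>x y. y *\<^sub>v r x) f \<in> koszul_syzygies n a"
proof -
  have I: "is_ideal I"
    by (simp add: I_def)
  have choice: "y *\<^sub>v (r x - s) \<in> koszul_syzygies n a"
    if "x \<in> I" "y \<in> I" "s \<in> freemod n" "lincomb n a s = x" for x y s
  proof (rule ideal_scale_syzygies)
    show "r x - s \<in> syzygies n a"
      using r that
      by (simp add: syzygies_eq_lincomb lincomb.diff funs.subspace_diff subspace_freemod)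
  qed (use that in \<open>simp add: I_def\<close>)
  show ?thesis
    using assms(4)
  proof (rule formal_eval_sym2_rel)
    fix x x' y assume "x \<in> I" "x' \<in> I" "y \<in> I"
    then have "y *\<^sub>v (r (x + x') - (r x + r x')) \<in> koszul_syzygies n a"
      using r I
      by (intro choice)
         (auto simp: lincomb.add intro: ideal.subspace_add funs.subspace_add subspace_freemod)
    then show "y *\<^sub>v r (x + x') - y *\<^sub>v r x - y *\<^sub>v r x' \<in> koszul_syzygies n a"
      by (simp add: algebra_simps)
  next
    fix c x y assume "x \<in> I" "y \<in> I"
    then have "y *\<^sub>v (r (c * x) - c *\<^sub>v r x) \<in> koszul_syzygies n a"
      using r I
      by (intro choice)
         (auto simp: lincomb.scale intro: ideal.subspace_scale funs.subspace_scale subspace_freemod)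
    then show "y *\<^sub>v r (c * x) - (c * y) *\<^sub>v r x \<in> koszul_syzygies n a"
      by (simp add: funs.scale_right_diff_distrib mult.commute)
  next
    show "y *\<^sub>v r x - x *\<^sub>v r y \<in> koszul_syzygies n a" if "x \<in> I" "y \<in> I" for x y
      using lincomb_commutator_in_koszul_syzygies[of "r x" n "r y" a] r that by simp
    show "(y + y') *\<^sub>v r x - y *\<^sub>v r x - y' *\<^sub>v r x \<in> koszul_syzygies n a" for x y y'
      by (simp add: funs.scale_left_distrib funs.subspace_0 subspace_koszul_syzygies)
  qed (auto intro: funs.subspace_0 funs.subspace_diff subspace_koszul_syzygies)
qed

lemma koszul_syzygies_of_sym2_comb:
  fixes a :: "nat \<Rightarrow> 'a::comm_ring_1" and n :: nat
  defines "I \<equiv> ideal_gen (a ` {..<n})"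
  assumes b: "b \<in> ideal_freemod I n" and "sym2_comb n a b \<in> sym2_rel I"
  shows "b \<in> koszul_syzygies n a"
proof -
  have "\<forall>x\<in>I. \<exists>r\<in>freemod n. lincomb n a r = x"
    by (auto simp: I_def ideal_gen_image_eq_lincomb)
  then obtain r where r: "\<And>x. x \<in> I \<Longrightarrow> r x \<in> freemod n" "\<And>x. x \<in> I \<Longrightarrow> lincomb n a (r x) = x"
    by metis
  have eval: "(\<Sum>i<n. b i *\<^sub>v r (a i)) \<in> koszul_syzygies n a"
    using formal_eval_coefficients_sym2_rel[of a n r "sym2_comb n a b"] assms(3) r
    unfolding I_def formal_eval_sym2_comb by blast
  have "b i *\<^sub>v (0(i := 1) - r (a i)) \<in> koszul_syzygies n a" if "i < n" for i
  proof (rule ideal_scale_syzygies)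
    have "a i \<in> I"
      using that by (simp add: I_def ideal.span_base)
    moreover have "(0(i := 1) :: nat \<Rightarrow> 'a) \<in> freemod n"
      using that by (simp add: freemod_def)
    ultimately show "0(i := 1) - r (a i) \<in> syzygies n a"
      using r that
      by (simp add: syzygies_eq_lincomb lincomb.diff lincomb_single funs.subspace_diff
          subspace_freemod)
    show "b i \<in> ideal_gen (a ` {..<n})"
      using b that by (simp add: I_def ideal_freemod_def)
  qed
  then have "(\<Sum>i<n. b i *\<^sub>v (0(i := 1) - r (a i))) \<in> koszul_syzygies n a"
    by (intro funs.subspace_sum subspace_koszul_syzygies) auto
  from funs.subspace_add[OF subspace_koszul_syzygies this eval]
  have "(\<Sum>i<n. b i *\<^sub>v 0(i := 1)) \<in> koszul_syzygies n a"
    by (simp add: funs.scale_right_diff_distrib sum_subtractf)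
  moreover have "b = (\<Sum>i<n. b i *\<^sub>v 0(i := 1))"
    using b by (auto simp: fun_eq_iff ideal_freemod_def freemod_def if_distrib[of "\<lambda>c. _ * c"]
        not_less cong: if_cong)
  ultimately show ?thesis
    by simp
qed

lemma formal_eval_mult_sym2_comb: "formal_eval (*) (sym2_comb n a b) = lincomb n a b"
  by (simp add: formal_eval_sym2_comb lincomb_def mult.commute)

lemma formal_eval_mult_sym2_eq:
  assumes "f \<in> funs.span (range fsym)" "g \<in> funs.span (range fsym)" "sym2_eq I f g"
  shows "formal_eval (*) f = formal_eval (*) g"
proof -
  have "formal_eval (*) (f - g) \<in> {0}"
    by (rule formal_eval_sym2_rel[of _ I]) (use assms(3) in \<open>auto simp: sym2_eq_def algebra_simps\<close>)
  with assms(1,2) show ?thesis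
    by (simp add: formal_eval_diff)
qed

lemma syzygetic_iff_koszul_syzygies:
  "syzygetic (ideal_gen (a ` {..<n})) \<longleftrightarrow>
     syzygies n a \<inter> ideal_freemod (ideal_gen (a ` {..<n})) n \<subseteq> koszul_syzygies n a"
proof (intro iffI subsetI)
  let ?I = "ideal_gen (a ` {..<n})"
  fix b assume syz: "syzygetic ?I" and b: "b \<in> syzygies n a \<inter> ideal_freemod ?I n"
  then have "sym2_comb n a b \<in> funs.span (fsym ` (?I \<times> ?I))"
    by (intro sym2_comb_in_span ideal.span_superset) simp
  moreover have "formal_eval (*) (sym2_comb n a b) = 0"
    using b by (simp add: formal_eval_mult_sym2_comb syzygies_eq_lincomb)
  ultimately have "sym2_comb n a b \<in> sym2_rel ?I"
    using syz by (simp add: syzygetic_iff_formal_eval)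
  with b show "b \<in> koszul_syzygies n a"
    by (auto intro: koszul_syzygies_of_sym2_comb)
next
  let ?I = "ideal_gen (a ` {..<n})"
  assume koszul: "syzygies n a \<inter> ideal_freemod ?I n \<subseteq> koszul_syzygies n a"
  show "syzygetic ?I"
    unfolding syzygetic_iff_formal_eval
  proof (intro ballI impI)
    fix f assume f: "f \<in> funs.span (fsym ` (?I \<times> ?I))" "formal_eval (*) f = 0"
    then obtain b where b: "b \<in> ideal_freemod ?I n" "sym2_eq ?I f (sym2_comb n a b)"
      using span_fsym_subset_sym2_comb_range[of a n] unfolding sym2_comb_range_def by blast
    have "f \<in> funs.span (range fsym)"
      using f(1) by (simp add: span_fsym)
    moreover have "sym2_comb n a b \<in> funs.span (range fsym)"
      by (simp add: sym2_comb_def funs.span_sum)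
    ultimately have "lincomb n a b = 0"
      using formal_eval_mult_sym2_eq[OF _ _ b(2)] f(2) by (simp add: formal_eval_mult_sym2_comb)
    with b(1) koszul have "b \<in> koszul_syzygies n a"
      by (auto simp: syzygies_eq_lincomb ideal_freemod_def)
    from sym2_eq_trans[OF b(2) sym2_comb_koszul_syzygies[OF this]] show "f \<in> sym2_rel ?I"
      by (simp add: sym2_eq_zero_iff)
  qed
qed

theorem mainTheorem11:
  fixes G :: "nat \<Rightarrow> 'a::comm_ring_1 set"
    and a :: "nat \<Rightarrow> 'a"
    and n :: nat
  assumes "noetherian_ring TYPE('a)"
    and "nat_graded G"
    and "n \<ge> 1"
    and "grade (irrelevant G) > grade (ideal_gen (a ` {..<n}))"
    and "grade (ideal_gen (a ` {..<n})) = enat (n - 1)"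
  shows "(koszul_syzygies n a = syzygies n a \<inter> ideal_freemod (ideal_gen (a ` {..<n})) n
          \<longleftrightarrow> koszul_syzygies n a = syzygies n a \<inter>
                ideal_freemod (TF (irrelevant G) (ideal_gen (a ` {..<n}))) n)
       \<and> (koszul_syzygies n a = syzygies n a \<inter>
                ideal_freemod (TF (irrelevant G) (ideal_gen (a ` {..<n}))) n
          \<longleftrightarrow> syzygetic (ideal_gen (a ` {..<n})))"
proof -
  let ?I = "ideal_gen (a ` {..<n})" and ?m = "irrelevant G"
  let ?B = "koszul_syzygies n a" and ?Z = "syzygies n a"
  have torsion_free: "ktorsion_free n a ?m {0} 1"
  proof (rule ktorsion_free_of_grade)
    show "n = 1 + (n - 1)"
      using assms(3) by simp
    show "enat (n - 1) \<le> grade ?I" "enat (Suc (n - 1)) \<le> grade ?m"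
      using assms(4,5) by (simp_all add: Suc_ile_eq)
  qed
  have "?B \<subseteq> ?Z \<inter> ideal_freemod ?I n"
    by (rule koszul_syzygies_subset)
  moreover have "?Z \<inter> ideal_freemod ?I n \<subseteq> ?Z \<inter> ideal_freemod (TF ?m ?I) n"
    using subset_TF[of ?I ?m] by (auto simp: ideal_freemod_def)
  moreover have "?Z \<inter> ideal_freemod (TF ?m ?I) n \<subseteq> ?B" if "?Z \<inter> ideal_freemod ?I n \<subseteq> ?B"
    using torsion_free that by (rule TF_syzygies_subset_koszul_syzygies)
  moreover have "syzygetic ?I \<longleftrightarrow> ?Z \<inter> ideal_freemod ?I n \<subseteq> ?B"
    by (rule syzygetic_iff_koszul_syzygies)
  ultimately show ?thesis
    by blast
qed

end
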